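(* Let ${}^{*}X$ be a directed functional extension of $X$, and let $I$, $\widehat{\alpha}$ ($\alpha\in{}^{*}X$), $\mathcal D$ and $\mathcal E$ be constructed as described in the context (for any admissible choices of the functions $f_{\xi\alpha}$ and of the ultrafilter $\mathcal V$). Then the map $\alpha\mapsto[\widehat{\alpha}]$ is an isomorphism of ${}^{*}X$ onto the limit ultrapower $X^{I}/\mathcal D\,|\,\mathcal E$ as structures for the language $\mathcal L=\{f\mid f:X\to X\}$; that is, it is a bijection from ${}^{*}X$ onto $X^I/\mathcal D\,|\,\mathcal E$ and, for every $g:X\to X$ and $\alpha\in{}^{*}X$, $[\widehat{{}^{*}g(\alpha)}]=[g\circ\widehat{\alpha}]$.
   Context: $X$ is a set with distinct elements $0,1\in X$. A functional extension of $X$ is a superset ${}^{*}X\supseteq X$ with an assignment to each $f:X\to X$ of ${}^{*}f:{}^{*}X\to{}^{*}X$ extending $f$ such that for all $f,g:X\to X$, $\xi\in{}^{*}X$: (comp) ${}^{*}g({}^{*}f(\xi))={}^{*}(g\circ f)(\xi)$; (diag) ${}^{*}(\chi\circ(f,g))(\xi)=1$ if ${}^{*}f(\xi)={}^{*}g(\xi)$ and $0$ otherwise, where $\chi:X\times X\to\{0,1\}$ is the characteristic function of the diagonal and $\chi\circ(f,g)$ is $x\mapsto\chi(f(x),g(x))$. It is directed if (dir) for all $\xi,\eta\in{}^{*}X$ there exist $f,g:X\to X$ and $\zeta\in{}^{*}X$ with ${}^{*}f(\zeta)=\xi$, ${}^{*}g(\zeta)=\eta$. For $A\subseteq X$, ${}^{*}A=\{\xi\mid{}^{*}\chi_A(\xi)=1\}$,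 $\chi_A$ the characteristic function of $A$. Construction: for $\alpha\in{}^{*}X$ let $\check\alpha=\{\xi\in{}^{*}X\mid \exists f:X\to X,\ {}^{*}f(\xi)=\alpha\}$ and for each $\xi\in\check\alpha$ fix $f_{\xi\alpha}:X\to X$ with ${}^{*}f_{\xi\alpha}(\xi)=\alpha$. The family $\{\check\alpha\mid\alpha\in{}^{*}X\}$ has the finite intersection property; let $\mathcal V$ be any ultrafilter on ${}^{*}X$ containing it. Put $I={}^{*}X\times X$ and define $\widehat\alpha:I\to X$ by $\widehat\alpha(\xi,x)=f_{\xi\alpha}(x)$ if $\xi\in\check\alpha$ and $\widehat\alpha(\xi,x)=x$ otherwise; let $E_\alpha=\{(i,j)\in I\times I\mid\widehat\alpha(i)=\widehat\alpha(j)\}$, and let $\mathcal E$ be the filter of equivalence relations on $I$ generated by $\{E_\alpha\mid\alpha\in{}^{*}X\}$ (i.e. all equivalence relations on $I$ containing some $E_\alpha$). For $\xi\in{}^{*}X$ let $\mathcal U_\xi=\{A\subseteq X\mid\xi\in{}^{*}A\}$, and let $\mathcal D$ be the ultrafilter on $I$ given by $D\in\mathcal D\iff\{\xi\in{}^{*}X\mid\{x\in X\mid(\xi,x)\in D\}\in\mathcal U_\xi\}\in\mathcal V$. Ultrapowers: for an ultrafilter $\mathcal U$ on $I$, $X^I/\mathcal U$ is the set of classes $[f]$ of functions $f:I\to X$ modulo agreement on a set in $\mathcal U$; each $g:X\to X$ is interpreted by $\bar g([f])=[g\circ f]$. For a filter $\mathcal E$ of equivalence relations on $I$, the limit ultrapower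 $X^I/\mathcal U\,|\,\mathcal E$ is the subset of classes $[f]$ of those $f:I\to X$ with $\{(i,j)\mid f(i)=f(j)\}\in\mathcal E$, with the induced interpretation of each $g$. *)

theory Defs
  imports Main "HOL-Library.FuncSet"
begin

text \<open>
  All carriers are sets, so that \<open>*X\<close> is literally a superset of \<open>X\<close>. A function \<open>X \<rightarrow> X\<close> is an element
  of the extensional function space \<open>X \<rightarrow>\<^sub>E X\<close>, so that equality of such functions is equality on \<open>X\<close>.
\<close>

definition char_fun :: "'a set \<Rightarrow> 'a \<Rightarrow> 'a \<Rightarrow> 'a set \<Rightarrow> 'a \<Rightarrow> 'a" where
  "char_fun X zero one A = (\<lambda>x\<in>X. if x \<in> A then one else zero)"

definition diag_fun :: "'a \<Rightarrow> 'a \<Rightarrow> 'a \<Rightarrow> 'a \<Rightarrow> 'a" where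
  "diag_fun zero one x y = (if x = y then one else zero)"

locale functional_extension =
  fixes X :: "'a set" and zero one :: 'a
    and SX :: "'a set"
    and star :: "('a \<Rightarrow> 'a) \<Rightarrow> 'a \<Rightarrow> 'a"
  assumes zero_in: "zero \<in> X" and one_in: "one \<in> X" and zero_neq_one: "zero \<noteq> one"
    and superset: "X \<subseteq> SX"
    and star_fun: "f \<in> X \<rightarrow>\<^sub>E X \<Longrightarrow> star f \<in> SX \<rightarrow> SX"
    and star_extends: "f \<in> X \<rightarrow>\<^sub>E X \<Longrightarrow> x \<in> X \<Longrightarrow> star f x = f x"
    and comp: "f \<in> X \<rightarrow>\<^sub>E X \<Longrightarrow> g \<in> X \<rightarrow>\<^sub>E X \<Longrightarrow> \<xi> \<in> SX \<Longrightarrow>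
      star g (star f \<xi>) = star (compose X g f) \<xi>"
    and diag: "f \<in> X \<rightarrow>\<^sub>E X \<Longrightarrow> g \<in> X \<rightarrow>\<^sub>E X \<Longrightarrow> \<xi> \<in> SX \<Longrightarrow>
      star (\<lambda>x\<in>X. diag_fun zero one (f x) (g x)) \<xi> = (if star f \<xi> = star g \<xi> then one else zero)"

locale directed_functional_extension = functional_extension +
  assumes dir: "\<xi> \<in> SX \<Longrightarrow> \<eta> \<in> SX \<Longrightarrow>
    \<exists>f \<in> X \<rightarrow>\<^sub>E X. \<exists>g \<in> X \<rightarrow>\<^sub>E X. \<exists>\<zeta> \<in> SX. star f \<zeta> = \<xi> \<and> star g \<zeta> = \<eta>"

definition star_set ::
  "'a set \<Rightarrow> 'a \<Rightarrow> 'a \<Rightarrow> 'a set \<Rightarrow> (('a \<Rightarrow> 'a) \<Rightarrow> 'a \<Rightarrow> 'a) \<Rightarrow> 'a set \<Rightarrow> 'a set" where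
  "star_set X zero one SX star A = {\<xi> \<in> SX. star (char_fun X zero one A) \<xi> = one}"

definition ultrafilter_on :: "'i set \<Rightarrow> 'i set set \<Rightarrow> bool" where
  "ultrafilter_on S U \<longleftrightarrow>
     U \<subseteq> Pow S \<and> S \<in> U \<and> {} \<notin> U \<and>
     (\<forall>A\<in>U. \<forall>B\<in>U. A \<inter> B \<in> U) \<and>
     (\<forall>A\<in>U. \<forall>B. A \<subseteq> B \<and> B \<subseteq> S \<longrightarrow> B \<in> U) \<and>
     (\<forall>A. A \<subseteq> S \<longrightarrow> A \<in> U \<or> S - A \<in> U)"

definition eq_kernel :: "'i set \<Rightarrow> ('i \<Rightarrow> 'a) \<Rightarrow> ('i \<times> 'i) set" where
  "eq_kernel I h = {(i, j) \<in> I \<times> I. h i = h j}"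

definition ultrapower_rel ::
  "'a set \<Rightarrow> 'i set \<Rightarrow> 'i set set \<Rightarrow> (('i \<Rightarrow> 'a) \<times> ('i \<Rightarrow> 'a)) set" where
  "ultrapower_rel X I U =
     {(f, g) \<in> (I \<rightarrow>\<^sub>E X) \<times> (I \<rightarrow>\<^sub>E X). {i \<in> I. f i = g i} \<in> U}"

definition ultrapower_class ::
  "'a set \<Rightarrow> 'i set \<Rightarrow> 'i set set \<Rightarrow> ('i \<Rightarrow> 'a) \<Rightarrow> ('i \<Rightarrow> 'a) set" where
  "ultrapower_class X I U f = ultrapower_rel X I U `` {f}"

definition ultrapower :: "'a set \<Rightarrow> 'i set \<Rightarrow> 'i set set \<Rightarrow> ('i \<Rightarrow> 'a) set set" where
  "ultrapower X I U = (I \<rightarrow>\<^sub>E X) // ultrapower_rel X I U"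

text \<open>
  The interpretation of \<open>g\<close> on classes. The union ranges over all representatives of \<open>c\<close>; for an
  ultrafilter it is the single class of \<open>g \<circ> f\<close> for any \<open>f \<in> c\<close>, see \<open>ultrapower_fun_class\<close>.
\<close>

definition ultrapower_fun ::
  "'a set \<Rightarrow> 'i set \<Rightarrow> 'i set set \<Rightarrow> ('a \<Rightarrow> 'a) \<Rightarrow> ('i \<Rightarrow> 'a) set \<Rightarrow> ('i \<Rightarrow> 'a) set" where
  "ultrapower_fun X I U g c = (\<Union>f\<in>c. ultrapower_class X I U (compose I g f))"

definition limit_ultrapower ::
  "'a set \<Rightarrow> 'i set \<Rightarrow> 'i set set \<Rightarrow> ('i \<times> 'i) set set \<Rightarrow> ('i \<Rightarrow> 'a) set set" where
  "limit_ultrapower X I U \<E> =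
     {c \<in> ultrapower X I U. \<exists>f \<in> I \<rightarrow>\<^sub>E X. c = ultrapower_class X I U f \<and> eq_kernel I f \<in> \<E>}"

lemma equiv_ultrapower_rel:
  assumes "ultrafilter_on I U"
  shows "equiv (I \<rightarrow>\<^sub>E X) (ultrapower_rel X I U)"
proof (rule equivI)
  show "ultrapower_rel X I U \<subseteq> (I \<rightarrow>\<^sub>E X) \<times> (I \<rightarrow>\<^sub>E X)"
    by (auto simp: ultrapower_rel_def)
  show "refl_on (I \<rightarrow>\<^sub>E X) (ultrapower_rel X I U)"
    using assms by (auto simp: refl_on_def ultrapower_rel_def ultrafilter_on_def)
  show "sym (ultrapower_rel X I U)"
    by (auto simp: sym_def ultrapower_rel_def eq_commute)
  show "trans (ultrapower_rel X I U)"
  proof (rule transI)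
    fix f g h
    assume fg: "(f, g) \<in> ultrapower_rel X I U" and gh: "(g, h) \<in> ultrapower_rel X I U"
    then have "{i \<in> I. f i = g i} \<inter> {i \<in> I. g i = h i} \<in> U"
      using assms by (auto simp: ultrapower_rel_def ultrafilter_on_def)
    moreover have "{i \<in> I. f i = g i} \<inter> {i \<in> I. g i = h i} \<subseteq> {i \<in> I. f i = h i}" by auto
    moreover have "{i \<in> I. f i = h i} \<subseteq> I" by auto
    ultimately have "{i \<in> I. f i = h i} \<in> U"
      using assms unfolding ultrafilter_on_def by meson
    then show "(f, h) \<in> ultrapower_rel X I U"
      using fg gh by (auto simp: ultrapower_rel_def)
  qed
qed

lemma ultrapower_fun_class:
  assumes U: "ultrafilter_on I U" and g: "g \<in> X \<rightarrow>\<^sub>E X" and f: "f \<in> I \<rightarrow>\<^sub>E X"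
  shows "ultrapower_fun X I U g (ultrapower_class X I U f) =
    ultrapower_class X I U (compose I g f)"
proof -
  note eq = equiv_ultrapower_rel[OF U, of X]
  have "(\<lambda>f. ultrapower_class X I U (compose I g f)) respects ultrapower_rel X I U"
  proof (rule congruentI)
    fix h k assume hk: "(h, k) \<in> ultrapower_rel X I U"
    have "{i \<in> I. h i = k i} \<subseteq> {i \<in> I. compose I g h i = compose I g k i}"
      by (auto simp: compose_def)
    moreover have "{i \<in> I. compose I g h i = compose I g k i} \<subseteq> I" by auto
    moreover have "{i \<in> I. h i = k i} \<in> U" using hk by (auto simp: ultrapower_rel_def)
    ultimately have "{i \<in> I. compose I g h i = compose I g k i} \<in> U"
      using U unfolding ultrafilter_on_def by meson
    moreover have "compose I g h \<in> I \<rightarrow>\<^sub>E X" "compose I g k \<in> I \<rightarrow>\<^sub>E X"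
      using hk g by (auto simp: ultrapower_rel_def compose_def PiE_iff)
    ultimately have "(compose I g h, compose I g k) \<in> ultrapower_rel X I U"
      by (simp add: ultrapower_rel_def)
    then show "ultrapower_class X I U (compose I g h) = ultrapower_class X I U (compose I g k)"
      unfolding ultrapower_class_def using eq by (rule equiv_class_eq[rotated])
  qed
  then show ?thesis
    unfolding ultrapower_fun_def using UN_equiv_class[OF eq _ f]
    by (simp add: ultrapower_class_def)
qed

text \<open>
  Isomorphism of structures for the language with one unary function symbol for each
  \<open>g : X \<rightarrow> X\<close>. A structure is a carrier together with an interpretation of these symbols.
\<close>

definition fun_language_iso ::
  "'a set \<Rightarrow> 'b set \<Rightarrow> (('a \<Rightarrow> 'a) \<Rightarrow> 'b \<Rightarrow> 'b) \<Rightarrow> 'c set \<Rightarrow> (('a \<Rightarrow> 'a) \<Rightarrow> 'c \<Rightarrow> 'c)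
    \<Rightarrow> ('b \<Rightarrow> 'c) \<Rightarrow> bool" where
  "fun_language_iso X A intA B intB \<phi> \<longleftrightarrow>
     bij_betw \<phi> A B \<and> (\<forall>g \<in> X \<rightarrow>\<^sub>E X. \<forall>a \<in> A. \<phi> (intA g a) = intB g (\<phi> a))"

definition check_set ::
  "'a set \<Rightarrow> 'a set \<Rightarrow> (('a \<Rightarrow> 'a) \<Rightarrow> 'a \<Rightarrow> 'a) \<Rightarrow> 'a \<Rightarrow> 'a set" where
  "check_set X SX star \<alpha> = {\<xi> \<in> SX. \<exists>f \<in> X \<rightarrow>\<^sub>E X. star f \<xi> = \<alpha>}"

text \<open>\<open>F \<xi> \<alpha>\<close> is the chosen function \<open>f\<^sub>\<xi>\<^sub>\<alpha>\<close>; it is only constrained for \<open>\<xi>\<close> in the check set of \<open>\<alpha>\<close>.\<close>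

definition admissible_choice ::
  "'a set \<Rightarrow> 'a set \<Rightarrow> (('a \<Rightarrow> 'a) \<Rightarrow> 'a \<Rightarrow> 'a) \<Rightarrow> ('a \<Rightarrow> 'a \<Rightarrow> 'a \<Rightarrow> 'a) \<Rightarrow> bool" where
  "admissible_choice X SX star F \<longleftrightarrow>
     (\<forall>\<alpha>\<in>SX. \<forall>\<xi> \<in> check_set X SX star \<alpha>. F \<xi> \<alpha> \<in> X \<rightarrow>\<^sub>E X \<and> star (F \<xi> \<alpha>) \<xi> = \<alpha>)"

definition hat_fun ::
  "'a set \<Rightarrow> 'a set \<Rightarrow> (('a \<Rightarrow> 'a) \<Rightarrow> 'a \<Rightarrow> 'a) \<Rightarrow> ('a \<Rightarrow> 'a \<Rightarrow> 'a \<Rightarrow> 'a)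
    \<Rightarrow> 'a \<Rightarrow> 'a \<times> 'a \<Rightarrow> 'a" where
  "hat_fun X SX star F \<alpha> =
     (\<lambda>(\<xi>, x) \<in> SX \<times> X. if \<xi> \<in> check_set X SX star \<alpha> then F \<xi> \<alpha> x else x)"

definition point_ultrafilter ::
  "'a set \<Rightarrow> 'a \<Rightarrow> 'a \<Rightarrow> 'a set \<Rightarrow> (('a \<Rightarrow> 'a) \<Rightarrow> 'a \<Rightarrow> 'a) \<Rightarrow> 'a \<Rightarrow> 'a set set" where
  "point_ultrafilter X zero one SX star \<xi> = {A. A \<subseteq> X \<and> \<xi> \<in> star_set X zero one SX star A}"

definition product_ultrafilter ::
  "'a set \<Rightarrow> 'a \<Rightarrow> 'a \<Rightarrow> 'a set \<Rightarrow> (('a \<Rightarrow> 'a) \<Rightarrow> 'a \<Rightarrow> 'a) \<Rightarrow> 'a set set \<Rightarrow> ('a \<times> 'a) set set" where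
  "product_ultrafilter X zero one SX star V =
     {D. D \<subseteq> SX \<times> X \<and>
         {\<xi> \<in> SX. {x \<in> X. (\<xi>, x) \<in> D} \<in> point_ultrafilter X zero one SX star \<xi>} \<in> V}"

text \<open>
  All equivalence relations on \<open>I\<close> containing some member of \<open>G\<close>. Finite intersections of members of
  \<open>G\<close> are not added: if \<open>G\<close> consists of the kernels of the functions \<open>hat \<alpha>\<close>, adding them does not
  change the resulting limit ultrapower, since by directedness any two \<open>hat \<alpha>\<close>, \<open>hat \<beta>\<close> agree modulo
  the ultrafilter with \<open>p \<circ> hat \<gamma>\<close>, \<open>q \<circ> hat \<gamma>\<close> for a common \<open>\<gamma>\<close>.
\<close>

definition generated_equivs :: "'i set \<Rightarrow> ('i \<times> 'i) set set \<Rightarrow> ('i \<times> 'i) set set" where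
  "generated_equivs I G = {R. equiv I R \<and> (\<exists>E\<in>G. E \<subseteq> R)}"

end

theory Submission
  imports Defs
begin

text \<open>
  By (diag), \<open>*f \<xi> = *g \<xi>\<close> holds iff \<open>{x. f x = g x} \<in> \<U>\<^sub>\<xi>\<close>. If \<open>\<xi>\<close> lies in the check sets
  of both \<open>\<alpha>\<close> and \<open>\<beta>\<close>, this says that the \<open>\<xi>\<close>-sections of \<open>hat \<alpha>\<close> and \<open>hat \<beta>\<close> agree modulo
  \<open>\<U>\<^sub>\<xi>\<close> iff \<open>\<alpha> = \<beta>\<close>, and that the \<open>\<xi>\<close>-section of \<open>g \<circ> hat \<alpha>\<close> agrees with that of \<open>hat (*g \<alpha>)\<close>.
  Since check sets belong to \<open>\<V>\<close>, injectivity and the homomorphism property follow. For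
  surjectivity, a function on \<open>I\<close> whose kernel contains that of \<open>hat \<alpha>\<close> factors as \<open>g \<circ> hat \<alpha>\<close>,
  hence represents the image of \<open>*g \<alpha>\<close>.
\<close>

section \<open>Sums of ultrafilters, classes in an ultrapower, and factorization through
  kernels\<close>

lemma ultrafilter_on_Int:
  "ultrafilter_on S U \<Longrightarrow> A \<in> U \<Longrightarrow> B \<in> U \<Longrightarrow> A \<inter> B \<in> U"
  by (simp add: ultrafilter_on_def)

lemma ultrafilter_on_superset:
  "ultrafilter_on S U \<Longrightarrow> A \<in> U \<Longrightarrow> A \<subseteq> B \<Longrightarrow> B \<subseteq> S \<Longrightarrow> B \<in> U"
  unfolding ultrafilter_on_def by meson

lemma ultrafilter_on_Compl:
  "ultrafilter_on S U \<Longrightarrow> A \<subseteq> S \<Longrightarrow> A \<notin> U \<Longrightarrow> S - A \<in> U"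
  unfolding ultrafilter_on_def by meson

text \<open>This is the \<open>V\<close>-sum of the ultrafilters \<open>U \<xi>\<close>. Each filter
  law holds section by section and is then transported to \<open>V\<close> through the set
  \<open>?base D\<close> of indices whose section of \<open>D\<close> is large.\<close>

lemma ultrafilter_on_sum:
  assumes V: "ultrafilter_on S V" and U: "\<And>\<xi>. \<xi> \<in> S \<Longrightarrow> ultrafilter_on T (U \<xi>)"
  shows "ultrafilter_on (S \<times> T) {D. D \<subseteq> S \<times> T \<and> {\<xi> \<in> S. {x \<in> T. (\<xi>, x) \<in> D} \<in> U \<xi>} \<in> V}"
    (is "ultrafilter_on _ ?W")
proof -
  let ?sec = "\<lambda>D \<xi>. {x \<in> T. (\<xi>, x) \<in> D}"
  let ?base = "\<lambda>D. {\<xi> \<in> S. ?sec D \<xi> \<in> U \<xi>}"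
  have full: "S \<times> T \<in> ?W"
  proof -
    have "?base (S \<times> T) = S"
      using U by (auto simp: ultrafilter_on_def)
    then show ?thesis using V by (simp add: ultrafilter_on_def)
  qed
  have empty: "{} \<notin> ?W"
  proof -
    have "?base {} = {}"
      using U by (auto simp: ultrafilter_on_def)
    then have "?base {} \<notin> V" using V by (simp only: ultrafilter_on_def) blast
    then show ?thesis by blast
  qed
  have Int: "A \<inter> B \<in> ?W" if "A \<in> ?W" "B \<in> ?W" for A B
  proof -
    have "?base A \<inter> ?base B \<in> V"
      using that by (auto intro: ultrafilter_on_Int[OF V])
    moreover have "?base A \<inter> ?base B \<subseteq> ?base (A \<inter> B)"
    proof
      fix \<xi> assume \<xi>: "\<xi> \<in> ?base A \<inter> ?base B"
      then have "?sec A \<xi> \<inter> ?sec B \<xi> \<in> U \<xi>"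
        using ultrafilter_on_Int[OF U] by simp
      moreover have "?sec A \<xi> \<inter> ?sec B \<xi> = ?sec (A \<inter> B) \<xi>" by blast
      ultimately show "\<xi> \<in> ?base (A \<inter> B)" using \<xi> by simp
    qed
    ultimately have "?base (A \<inter> B) \<in> V"
      by (rule ultrafilter_on_superset[OF V]) blast
    then show ?thesis using that by blast
  qed
  have superset: "B \<in> ?W" if "A \<in> ?W" "A \<subseteq> B" "B \<subseteq> S \<times> T" for A B
  proof -
    have "?base A \<subseteq> ?base B"
    proof
      fix \<xi> assume \<xi>: "\<xi> \<in> ?base A"
      have "?sec B \<xi> \<in> U \<xi>"
        by (rule ultrafilter_on_superset[OF U, of _ "?sec A \<xi>"]) (use \<xi> that in auto)
      then show "\<xi> \<in> ?base B" using \<xi> by simp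
    qed
    then have "?base B \<in> V"
      using ultrafilter_on_superset[OF V, of "?base A" "?base B"] that by blast
    then show ?thesis using that by blast
  qed
  have ultra: "A \<in> ?W \<or> S \<times> T - A \<in> ?W" if "A \<subseteq> S \<times> T" for A
  proof (cases "?base A \<in> V")
    case True
    then show ?thesis using that by blast
  next
    case False
    then have "S - ?base A \<in> V"
      by (intro ultrafilter_on_Compl[OF V]) auto
    \<comment> \<open>Each \<open>U \<xi>\<close> decides the section of \<open>A\<close>, so an
      index that rejects \<open>A\<close> accepts its complement.\<close>
    moreover have "S - ?base A \<subseteq> ?base (S \<times> T - A)"
    proof
      fix \<xi> assume \<xi>: "\<xi> \<in> S - ?base A"
      then have "T - ?sec A \<xi> \<in> U \<xi>"
        by (intro ultrafilter_on_Compl[OF U]) auto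
      moreover have "T - ?sec A \<xi> = ?sec (S \<times> T - A) \<xi>" using \<xi> by blast
      ultimately show "\<xi> \<in> ?base (S \<times> T - A)" using \<xi> by simp
    qed
    ultimately have "?base (S \<times> T - A) \<in> V"
      by (rule ultrafilter_on_superset[OF V]) blast
    then show ?thesis by blast
  qed
  show ?thesis
    unfolding ultrafilter_on_def[of "S \<times> T"]
  proof (intro conjI ballI allI impI)
    show "?W \<subseteq> Pow (S \<times> T)" by blast
    show "B \<in> ?W" if "A \<in> ?W" "A \<subseteq> B \<and> B \<subseteq> S \<times> T" for A B
      using superset that by simp
  qed (fact full empty Int ultra)+
qed

lemma ultrapower_class_eq_iff:
  assumes "ultrafilter_on I U" and "f \<in> I \<rightarrow>\<^sub>E X" and "g \<in> I \<rightarrow>\<^sub>E X"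
  shows "ultrapower_class X I U f = ultrapower_class X I U g \<longleftrightarrow> {i \<in> I. f i = g i} \<in> U"
  using eq_equiv_class_iff[OF equiv_ultrapower_rel[OF assms(1)] assms(2,3)] assms(2,3)
  by (simp add: ultrapower_class_def ultrapower_rel_def)

lemma ultrapower_class_in_limit_ultrapower:
  assumes "f \<in> I \<rightarrow>\<^sub>E X" and "eq_kernel I f \<in> \<E>"
  shows "ultrapower_class X I U f \<in> limit_ultrapower X I U \<E>"
  using assms
  by (auto simp: limit_ultrapower_def ultrapower_def ultrapower_class_def intro: quotientI)

text \<open>On the range of \<open>h\<close>, \<open>g\<close> is read off from \<open>f\<close> at
  a chosen preimage. The point \<open>y\<close> is a default value off the range, where the
  factorization imposes nothing.\<close>

lemma eq_kernel_factorization: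
  assumes h: "h \<in> I \<rightarrow>\<^sub>E X" and f: "f \<in> I \<rightarrow>\<^sub>E Y" and "y \<in> Y"
    and ker: "eq_kernel I h \<subseteq> eq_kernel I f"
  obtains g where "g \<in> X \<rightarrow>\<^sub>E Y" and "f = compose I g h"
proof
  let ?g = "\<lambda>x\<in>X. if x \<in> h ` I then f (inv_into I h x) else y"
  show "?g \<in> X \<rightarrow>\<^sub>E Y"
    using \<open>y \<in> Y\<close> by (auto intro!: PiE_mem[OF f] inv_into_into)
  show "f = compose I ?g h"
  proof (rule extensionalityI[where A = I])
    fix i assume i: "i \<in> I"
    \<comment> \<open>The chosen preimage of \<open>h i\<close> may differ from \<open>i\<close>,
      but \<open>h\<close> does not separate the two, hence neither does \<open>f\<close>.\<close>
    then have "(inv_into I h (h i), i) \<in> eq_kernel I h"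
      by (simp add: eq_kernel_def inv_into_into f_inv_into_f)
    then have "f (inv_into I h (h i)) = f i"
      using ker by (auto simp: eq_kernel_def)
    then show "f i = compose I ?g h i"
      using i h by (auto simp: compose_def)
  qed (use f in \<open>auto simp: compose_def PiE_def\<close>)
qed

lemma equiv_eq_kernel: "equiv I (eq_kernel I h)"
  by (rule equivI) (auto simp: eq_kernel_def refl_on_def sym_def trans_def)

section \<open>The sets \<open>points \<xi>\<close> are ultrafilters on \<open>X\<close>\<close>

context functional_extension
begin

abbreviation points :: "'a \<Rightarrow> 'a set set" where
  "points \<equiv> point_ultrafilter X zero one SX star"

lemma char_fun_in [simp]: "char_fun X zero one A \<in> X \<rightarrow>\<^sub>E X"
  using zero_in one_in by (auto simp: char_fun_def)

lemma in_points_iff: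
  "\<xi> \<in> SX \<Longrightarrow> A \<in> points \<xi> \<longleftrightarrow> A \<subseteq> X \<and> star (char_fun X zero one A) \<xi> = one"
  by (auto simp: point_ultrafilter_def star_set_def)

text \<open>This is (diag) in terms of sets, since \<chi> composed with (f, g) is the characteristic
  function of the equalizer. The value \<open>zero\<close> in the other case is kept for
  \<open>star_char_fun\<close>.\<close>

lemma star_char_fun_equalizer:
  assumes "f \<in> X \<rightarrow>\<^sub>E X" and "g \<in> X \<rightarrow>\<^sub>E X" and "\<xi> \<in> SX"
  shows "star (char_fun X zero one {x \<in> X. f x = g x}) \<xi> = (if star f \<xi> = star g \<xi> then one else zero)"
proof -
  have "char_fun X zero one {x \<in> X. f x = g x} = (\<lambda>x\<in>X. diag_fun zero one (f x) (g x))"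
    by (auto simp: char_fun_def diag_fun_def)
  then show ?thesis using diag[OF assms] by simp
qed

lemma equalizer_in_points_iff:
  assumes "f \<in> X \<rightarrow>\<^sub>E X" and "g \<in> X \<rightarrow>\<^sub>E X" and "\<xi> \<in> SX"
  shows "{x \<in> X. f x = g x} \<in> points \<xi> \<longleftrightarrow> star f \<xi> = star g \<xi>"
  using star_char_fun_equalizer[OF assms] zero_neq_one assms(3) by (auto simp: in_points_iff)

text \<open>Applying (diag) to two equal functions settles the constant \<open>one\<close>. Any
  other constant is itself composed with the constant \<open>one\<close>, so (comp) reduces its star
  value at \<xi> to its value at the standard point \<open>one\<close>.\<close>

lemma star_const:
  assumes a: "a \<in> X" and \<xi>: "\<xi> \<in> SX"
  shows "star (\<lambda>x\<in>X. a) \<xi> = a"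
proof -
  have const_in: "(\<lambda>x\<in>X. b) \<in> X \<rightarrow>\<^sub>E X" if "b \<in> X" for b
    using that by auto
  have one: "star (\<lambda>x\<in>X. one) \<xi> = one"
    using diag[OF const_in[OF a] const_in[OF a] \<xi>] a
    by (simp add: diag_fun_def cong: restrict_cong)
  have "compose X (\<lambda>x\<in>X. a) (\<lambda>x\<in>X. one) = (\<lambda>x\<in>X. a)"
    using one_in by (auto simp: compose_def)
  then have "star (\<lambda>x\<in>X. a) \<xi> = star (\<lambda>x\<in>X. a) (star (\<lambda>x\<in>X. one) \<xi>)"
    using comp[OF const_in[OF one_in] const_in[OF a] \<xi>] by simp
  also have "\<dots> = a"
    using one star_extends[OF const_in[OF a] one_in] one_in by simp
  finally show ?thesis .
qed

text \<open>A fibre is the equalizer of \<open>f\<close> with a constant function.\<close>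

lemma fibre_in_points_iff:
  assumes "f \<in> X \<rightarrow>\<^sub>E X" and "a \<in> X" and "\<xi> \<in> SX"
  shows "{x \<in> X. f x = a} \<in> points \<xi> \<longleftrightarrow> star f \<xi> = a"
proof -
  have "{x \<in> X. f x = a} = {x \<in> X. f x = (\<lambda>x\<in>X. a) x}" by auto
  then show ?thesis
    using equalizer_in_points_iff[of f "\<lambda>x\<in>X. a" \<xi>] assms star_const by auto
qed

text \<open>\<open>A\<close> is the equalizer of its characteristic function with the constant
  \<open>one\<close>, so (diag) forces a star value in {0, 1}.\<close>

lemma star_char_fun:
  assumes "A \<subseteq> X" and "\<xi> \<in> SX"
  shows "star (char_fun X zero one A) \<xi> = (if A \<in> points \<xi> then one else zero)"
proof -
  have const: "(\<lambda>x\<in>X. one) \<in> X \<rightarrow>\<^sub>E X" using one_in by auto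
  have "{x \<in> X. char_fun X zero one A x = (\<lambda>x\<in>X. one) x} = A"
    using assms zero_neq_one by (auto simp: char_fun_def)
  from star_char_fun_equalizer[OF char_fun_in[of A] const assms(2), unfolded this]
  show ?thesis
    using assms by (simp add: in_points_iff star_const[OF one_in])
qed

text \<open>The set on the left is the equalizer of two characteristic functions, so membership in
  \<open>points \<xi>\<close> commutes with the biconditional. Complements follow at once by taking
  \<open>B\<close> empty; intersections also use \<open>points_Int_nonempty\<close>.\<close>

lemma points_xnor:
  assumes "A \<subseteq> X" and "B \<subseteq> X" and "\<xi> \<in> SX"
  shows "{x \<in> X. x \<in> A \<longleftrightarrow> x \<in> B} \<in> points \<xi> \<longleftrightarrow> (A \<in> points \<xi> \<longleftrightarrow> B \<in> points \<xi>)"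
proof -
  have "{x \<in> X. x \<in> A \<longleftrightarrow> x \<in> B} = {x \<in> X. char_fun X zero one A x = char_fun X zero one B x}"
    using zero_neq_one by (auto simp: char_fun_def)
  then show ?thesis
    using equalizer_in_points_iff[of "char_fun X zero one A" "char_fun X zero one B" \<xi>]
      assms zero_neq_one by (auto simp: star_char_fun)
qed

lemma empty_notin_points: "\<xi> \<in> SX \<Longrightarrow> {} \<notin> points \<xi>"
  using star_const[OF zero_in, of \<xi>] zero_neq_one
  by (simp add: in_points_iff char_fun_def)

lemma points_Compl:
  assumes "A \<subseteq> X" and "\<xi> \<in> SX"
  shows "X - A \<in> points \<xi> \<longleftrightarrow> A \<notin> points \<xi>"
proof -
  have "X - A = {x \<in> X. x \<in> A \<longleftrightarrow> x \<in> {}}" by auto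
  then show ?thesis
    using points_xnor[of A "{}" \<xi>] assms empty_notin_points by auto
qed

lemma points_Int_nonempty:
  assumes "A \<in> points \<xi>" and "B \<in> points \<xi>" and \<xi>: "\<xi> \<in> SX"
  shows "A \<inter> B \<noteq> {}"
proof
  assume disj: "A \<inter> B = {}"
  have sub: "A \<subseteq> X" "B \<subseteq> X" using assms by (auto simp: in_points_iff)
  obtain a b where ab: "a \<in> A" "b \<in> B"
    using assms empty_notin_points by fastforce
  \<comment> \<open>A map sending \<open>A\<close> to \<open>a\<close>, \<open>B\<close> to \<open>b\<close> and nothing else to either would have
    star value both \<open>a\<close> and \<open>b\<close> at \<open>\<xi>\<close>.\<close>
  define f where "f = (\<lambda>x\<in>X. if x \<in> A then a else if x \<in> B then b else x)"
  have f: "f \<in> X \<rightarrow>\<^sub>E X" using ab sub by (auto simp: f_def)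
  have "{x \<in> X. f x = a} = A" "{x \<in> X. f x = b} = B"
    using ab sub disj by (auto simp: f_def)
  then have "star f \<xi> = a" "star f \<xi> = b"
    using assms fibre_in_points_iff[OF f _ \<xi>] ab sub by blast+
  then show False using ab disj by blast
qed

lemma ultrafilter_on_points:
  assumes \<xi>: "\<xi> \<in> SX"
  shows "ultrafilter_on X (points \<xi>)"
proof -
  have subX: "A \<subseteq> X" if "A \<in> points \<xi>" for A
    using that \<xi> by (simp add: in_points_iff)
  have full: "X \<in> points \<xi>"
    using points_Compl[of "{}" \<xi>] empty_notin_points \<xi> by simp
  \<comment> \<open>Otherwise the complement of \<open>B\<close> would be a member disjoint from
    \<open>A\<close>.\<close>
  have superset: "B \<in> points \<xi>" if "A \<in> points \<xi>" "A \<subseteq> B" "B \<subseteq> X" for A B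
    using points_Int_nonempty[OF that(1), of "X - B"] points_Compl[of B \<xi>] that \<xi> by blast
  have Int: "A \<inter> B \<in> points \<xi>" if A: "A \<in> points \<xi>" and B: "B \<in> points \<xi>" for A B
  proof -
    \<comment> \<open>The complement of the intersection is the biconditional of these two sets.
      \<open>?N\<close> is a member and \<open>?C\<close>, being disjoint from \<open>A\<close>, is
      not, so \<open>points_xnor\<close> excludes that complement.\<close>
    let ?N = "{x \<in> X. x \<in> A \<longleftrightarrow> x \<in> B}" and ?C = "X - (A \<union> B)"
    have N: "?N \<in> points \<xi>"
      using points_xnor[of A B \<xi>] A B subX \<xi> by blast
    have C: "?C \<notin> points \<xi>"
      using points_Int_nonempty[OF A, of ?C] \<xi> by blast
    have "{x \<in> X. x \<in> ?N \<longleftrightarrow> x \<in> ?C} = X - (A \<inter> B)"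
      by blast
    then have "X - (A \<inter> B) \<notin> points \<xi>"
      using points_xnor[of ?N ?C \<xi>] N C \<xi> by auto
    then show ?thesis
      using points_Compl[of "A \<inter> B" \<xi>] subX[OF A] \<xi> by blast
  qed
  show ?thesis
    unfolding ultrafilter_on_def
  proof (intro conjI ballI allI impI)
    show "points \<xi> \<subseteq> Pow X" using subX by blast
    show "B \<in> points \<xi>" if "A \<in> points \<xi>" "A \<subseteq> B \<and> B \<subseteq> X" for A B
      using superset that by simp
    show "A \<in> points \<xi> \<or> X - A \<in> points \<xi>" if "A \<subseteq> X" for A
      using points_Compl[OF that \<xi>] by simp
  qed (fact full empty_notin_points[OF \<xi>] Int)+
qed

section \<open>The ultrafilter on pairs and agreement of hat functions modulo it\<close>

lemma ultrafilter_on_product_ultrafilter: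
  "ultrafilter_on SX V \<Longrightarrow> ultrafilter_on (SX \<times> X) (product_ultrafilter X zero one SX star V)"
  unfolding product_ultrafilter_def by (rule ultrafilter_on_sum[OF _ ultrafilter_on_points])

lemma hat_fun_in:
  assumes "admissible_choice X SX star F" and "\<alpha> \<in> SX"
  shows "hat_fun X SX star F \<alpha> \<in> SX \<times> X \<rightarrow>\<^sub>E X"
proof (rule PiE_I)
  fix i assume i: "i \<in> SX \<times> X"
  obtain \<xi> x where "i = (\<xi>, x)" by (cases i)
  then show "hat_fun X SX star F \<alpha> i \<in> X"
    using assms i by (auto simp: hat_fun_def admissible_choice_def PiE_iff)
qed (simp add: hat_fun_def)

text \<open>One equivalence serves both uses: \<beta> = \<open>star g \<alpha>\<close> gives the
  homomorphism property, and \<open>g\<close> the identity gives injectivity.\<close>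

lemma compose_hat_fun_agree_iff:
  assumes F: "admissible_choice X SX star F" and V: "ultrafilter_on SX V"
    and check: "\<forall>\<alpha>\<in>SX. check_set X SX star \<alpha> \<in> V"
    and \<alpha>: "\<alpha> \<in> SX" and \<beta>: "\<beta> \<in> SX" and g: "g \<in> X \<rightarrow>\<^sub>E X"
  shows "{i \<in> SX \<times> X. compose (SX \<times> X) g (hat_fun X SX star F \<alpha>) i = hat_fun X SX star F \<beta> i}
      \<in> product_ultrafilter X zero one SX star V \<longleftrightarrow> star g \<alpha> = \<beta>"
    (is "?D \<in> _ \<longleftrightarrow> _")
proof -
  let ?K = "check_set X SX star \<alpha> \<inter> check_set X SX star \<beta>"
  let ?base = "{\<xi> \<in> SX. {x \<in> X. (\<xi>, x) \<in> ?D} \<in> points \<xi>}"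
  have K: "?K \<in> V"
    using check \<alpha> \<beta> by (auto intro: ultrafilter_on_Int[OF V])
  \<comment> \<open>The right-hand side does not mention \<xi>, so \<open>?base\<close> either
    contains the large set \<open>?K\<close> or misses it entirely.\<close>
  have base_iff: "\<xi> \<in> ?base \<longleftrightarrow> star g \<alpha> = \<beta>" if \<xi>K: "\<xi> \<in> ?K" for \<xi>
  proof -
    have \<xi>: "\<xi> \<in> SX" using \<xi>K by (simp add: check_set_def)
    have F\<alpha>: "F \<xi> \<alpha> \<in> X \<rightarrow>\<^sub>E X" "star (F \<xi> \<alpha>) \<xi> = \<alpha>"
      and F\<beta>: "F \<xi> \<beta> \<in> X \<rightarrow>\<^sub>E X" "star (F \<xi> \<beta>) \<xi> = \<beta>"
      using F \<alpha> \<beta> \<xi>K by (auto simp: admissible_choice_def)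
    have gF: "compose X g (F \<xi> \<alpha>) \<in> X \<rightarrow>\<^sub>E X"
      using g F\<alpha>(1) by (auto simp: compose_def PiE_iff)
    have "{x \<in> X. (\<xi>, x) \<in> ?D} = {x \<in> X. compose X g (F \<xi> \<alpha>) x = F \<xi> \<beta> x}"
      using \<xi>K \<xi> by (auto simp: hat_fun_def compose_def)
    then have "\<xi> \<in> ?base \<longleftrightarrow> star (compose X g (F \<xi> \<alpha>)) \<xi> = star (F \<xi> \<beta>) \<xi>"
      using equalizer_in_points_iff[OF gF F\<beta>(1) \<xi>] \<xi> by simp
    then show ?thesis
      using comp[OF F\<alpha>(1) g \<xi>] F\<alpha>(2) F\<beta>(2) by simp
  qed
  have "?base \<in> V \<longleftrightarrow> star g \<alpha> = \<beta>"
  proof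
    assume "?base \<in> V"
    then have "?base \<inter> ?K \<in> V" using K by (rule ultrafilter_on_Int[OF V])
    then have "?base \<inter> ?K \<noteq> {}" using V by (auto simp: ultrafilter_on_def)
    then show "star g \<alpha> = \<beta>" using base_iff by blast
  next
    assume "star g \<alpha> = \<beta>"
    then have "?K \<subseteq> ?base" using base_iff by blast
    with K show "?base \<in> V" by (rule ultrafilter_on_superset[OF V]) blast
  qed
  moreover have "?D \<subseteq> SX \<times> X" by blast
  ultimately show ?thesis by (simp add: product_ultrafilter_def)
qed

end

context directed_functional_extension
begin

text \<open>Directedness enters here: it presents \<xi> as a value \<open>star f \<zeta>\<close>, on
  which (comp) absorbs the identity.\<close>

lemma star_id:
  assumes "\<xi> \<in> SX"
  shows "star (\<lambda>x\<in>X. x) \<xi> = \<xi>"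
proof -
  obtain f \<zeta> where f: "f \<in> X \<rightarrow>\<^sub>E X" "\<zeta> \<in> SX" "star f \<zeta> = \<xi>"
    using dir[OF assms assms] by blast
  have "compose X (\<lambda>x\<in>X. x) f = f"
    using f(1) by (intro Id_compose) (auto simp: PiE_iff)
  then show ?thesis
    using comp[OF f(1) _ f(2), of "\<lambda>x\<in>X. x"] f(3) by simp
qed

end

theorem theorem2p1:
  fixes X SX :: "'a set" and zero one :: 'a
    and star :: "('a \<Rightarrow> 'a) \<Rightarrow> 'a \<Rightarrow> 'a"
    and F :: "'a \<Rightarrow> 'a \<Rightarrow> 'a \<Rightarrow> 'a"
    and V :: "'a set set"
    and I :: "('a \<times> 'a) set"
    and hat :: "'a \<Rightarrow> 'a \<times> 'a \<Rightarrow> 'a"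
    and \<D> :: "('a \<times> 'a) set set"
    and \<E> :: "(('a \<times> 'a) \<times> ('a \<times> 'a)) set set"
  assumes "directed_functional_extension X zero one SX star"
    and "admissible_choice X SX star F"
    and "ultrafilter_on SX V"
    and "\<forall>\<alpha>\<in>SX. check_set X SX star \<alpha> \<in> V"
    and "I = SX \<times> X"
    and "hat = hat_fun X SX star F"
    and "\<D> = product_ultrafilter X zero one SX star V"
    and "\<E> = generated_equivs I {eq_kernel I (hat \<alpha>) | \<alpha>. \<alpha> \<in> SX}"
  shows "fun_language_iso X
           SX star
           (limit_ultrapower X I \<D> \<E>) (ultrapower_fun X I \<D>)
           (\<lambda>\<alpha>. ultrapower_class X I \<D> (hat \<alpha>))
       \<and> (\<forall>g \<in> X \<rightarrow>\<^sub>E X. \<forall>\<alpha>\<in>SX.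
           ultrapower_class X I \<D> (hat (star g \<alpha>)) =
           ultrapower_class X I \<D> (compose I g (hat \<alpha>)))"
proof -
  interpret directed_functional_extension X zero one SX star by fact
  note F = assms(2) and V = assms(3) and check = assms(4) and defs = assms(5-8)
  let ?cl = "ultrapower_class X I \<D>"
  have D: "ultrafilter_on I \<D>"
    using ultrafilter_on_product_ultrafilter[OF V] by (simp add: defs)
  have hat_in: "hat \<alpha> \<in> I \<rightarrow>\<^sub>E X" if "\<alpha> \<in> SX" for \<alpha>
    using hat_fun_in[OF F that] by (simp add: defs)
  have cl_iff: "?cl (compose I g (hat \<alpha>)) = ?cl (hat \<beta>) \<longleftrightarrow> star g \<alpha> = \<beta>"
    if "g \<in> X \<rightarrow>\<^sub>E X" "\<alpha> \<in> SX" "\<beta> \<in> SX" for g \<alpha> \<beta>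
  proof -
    have "compose I g (hat \<alpha>) \<in> I \<rightarrow>\<^sub>E X"
      using that hat_in[of \<alpha>] by (auto simp: compose_def PiE_iff)
    then show ?thesis
      using ultrapower_class_eq_iff[OF D _ hat_in[OF that(3)]]
        compose_hat_fun_agree_iff[OF F V check that(2,3,1)] by (simp add: defs)
  qed
  have star_in: "star g \<alpha> \<in> SX" if "g \<in> X \<rightarrow>\<^sub>E X" "\<alpha> \<in> SX" for g \<alpha>
    using star_fun that by blast
  have hom: "?cl (hat (star g \<alpha>)) = ?cl (compose I g (hat \<alpha>))"
    if "g \<in> X \<rightarrow>\<^sub>E X" "\<alpha> \<in> SX" for g \<alpha>
    using cl_iff[OF that star_in[OF that]] by simp
  have "inj_on (\<lambda>\<alpha>. ?cl (hat \<alpha>)) SX"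
  proof (rule inj_onI)
    fix \<alpha> \<beta> assume \<alpha>\<beta>: "\<alpha> \<in> SX" "\<beta> \<in> SX" "?cl (hat \<alpha>) = ?cl (hat \<beta>)"
    \<comment> \<open>Inserting the identity brings the equality of classes into the form covered by
      \<open>cl_iff\<close>.\<close>
    have "compose I (\<lambda>x\<in>X. x) (hat \<alpha>) = hat \<alpha>"
      using hat_in[OF \<alpha>\<beta>(1)] by (intro Id_compose) (auto simp: PiE_iff)
    then show "\<alpha> = \<beta>"
      using cl_iff[of "\<lambda>x\<in>X. x" \<alpha> \<beta>] \<alpha>\<beta> star_id[OF \<alpha>\<beta>(1)] by simp
  qed
  moreover have "?cl (hat \<alpha>) \<in> limit_ultrapower X I \<D> \<E>" if "\<alpha> \<in> SX" for \<alpha>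
    using hat_in[OF that] equiv_eq_kernel that
    by (intro ultrapower_class_in_limit_ultrapower) (auto simp: assms(8) generated_equivs_def)
  moreover have "c \<in> (\<lambda>\<alpha>. ?cl (hat \<alpha>)) ` SX" if c: "c \<in> limit_ultrapower X I \<D> \<E>" for c
  proof -
    \<comment> \<open>The representative \<open>f\<close> is one whose kernel lies in
      \<open>\<E>\<close>; \<alpha> indexes a generator contained in that kernel.\<close>
    obtain f \<alpha> where f: "f \<in> I \<rightarrow>\<^sub>E X" "c = ?cl f" and \<alpha>: "\<alpha> \<in> SX"
      and ker: "eq_kernel I (hat \<alpha>) \<subseteq> eq_kernel I f"
      using c unfolding limit_ultrapower_def assms(8) generated_equivs_def by blast
    obtain g where g: "g \<in> X \<rightarrow>\<^sub>E X" "f = compose I g (hat \<alpha>)"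
      using eq_kernel_factorization[OF hat_in[OF \<alpha>] f(1) zero_in ker] .
    then show ?thesis
      using hom[OF g(1) \<alpha>] star_in[OF g(1) \<alpha>] f(2) by auto
  qed
  ultimately have "bij_betw (\<lambda>\<alpha>. ?cl (hat \<alpha>)) SX (limit_ultrapower X I \<D> \<E>)"
    unfolding bij_betw_def by blast
  moreover have "?cl (hat (star g \<alpha>)) = ultrapower_fun X I \<D> g (?cl (hat \<alpha>))"
    if "g \<in> X \<rightarrow>\<^sub>E X" "\<alpha> \<in> SX" for g \<alpha>
    using hom[OF that] ultrapower_fun_class[OF D that(1) hat_in[OF that(2)]] by simp
  ultimately show ?thesis
    using hom by (simp add: fun_language_iso_def)
qed

end
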